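(* For every $n\ge1$, \[ \sum_{\sigma\in P_n}x^{\mathrm{des}_B(\sigma)}=\sum_{e\in I'_{2n}}x^{\mathrm{asc}(e)} \qquad\text{and}\qquad \sum_{\sigma\in U_n}x^{\mathrm{des}_B(\sigma)}=\sum_{e\in I'_{2n-1}}x^{\mathrm{asc}(e)}. \]
   Context: A signed permutation on a multiset $M$ of positive integers is a word $\sigma=\sigma_1\cdots\sigma_m$ obtained by arranging the elements of $M$ in some order and possibly negating each letter. Letters are compared as integers. Define $\mathrm{Des}_B(\sigma)=\{i:1\le i\le m-1,\ \sigma_i>\sigma_{i+1}\}\cup\{m\text{ if }\sigma_m>0\}$ and $\mathrm{des}_B(\sigma)=|\mathrm{Des}_B(\sigma)|$. $P_n$ is the set of signed permutations on $\{1^2,2^2,\ldots,n^2\}$. $U_n$ is the set of signed permutations on $\{1^2,2^2,\ldots,(n-1)^2,n\}$. For a sequence $s=(s_1,s_2,\ldots)$ of positive integers, an $s$-inversion sequence of length $m$ is a sequence $e=(e_1,\ldots,e_m)$ of integers with $0\le e_i<s_i$. Set $e_0=0$ and $s_0=1$. An ascent of $e$ is an index $i\in\{0,\ldots,m-1\}$ with $e_i/s_i<e_{i+1}/s_{i+1}$, and $\mathrm{asc}(e)$ is the number of ascents. $I'_m$ is the set of $s$-inversion sequences of length $m$ for $s_{2i}=2i$ and $s_{2i-1}=4i-2$ ($i\ge1$), i.e. $s=(2,2,6,4,10,6,\ldots)$. *)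

theory Defs
  imports Complex_Main "HOL-Library.Multiset" "HOL-Computational_Algebra.Polynomial"
begin

text \<open>A word is a list of integers; its letters \<open>\<sigma>\<^sub>1, \<dots>, \<sigma>\<^sub>m\<close> are
  \<open>\<sigma> ! 0, \<dots>, \<sigma> ! (m - 1)\<close>. The multiset \<open>M\<close> is meant to have positive elements only.\<close>

definition signed_perms :: "int multiset \<Rightarrow> int list set" where
  "signed_perms M = {\<sigma>. mset (map abs \<sigma>) = M}"

definition Des_B :: "int list \<Rightarrow> nat set" where
  "Des_B \<sigma> = {i. 1 \<le> i \<and> i \<le> length \<sigma> - 1 \<and> \<sigma> ! (i - 1) > \<sigma> ! i}
           \<union> {i. i = length \<sigma> \<and> 1 \<le> i \<and> \<sigma> ! (i - 1) > 0}"

definition des_B :: "int list \<Rightarrow> nat" where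
  "des_B \<sigma> = card (Des_B \<sigma>)"

definition P_perms :: "nat \<Rightarrow> int list set" where
  "P_perms n = signed_perms (\<Sum>k\<in>{1..n}. replicate_mset 2 (int k))"

definition U_perms :: "nat \<Rightarrow> int list set" where
  "U_perms n = signed_perms ((\<Sum>k\<in>{1..n-1}. replicate_mset 2 (int k)) + {#int n#})"

text \<open>The sequence \<open>s\<close> is indexed from \<open>1\<close>; the value \<open>s 0\<close> is never used, since the convention
  \<open>e\<^sub>0 = 0\<close>, \<open>s\<^sub>0 = 1\<close> is built into \<open>inv_ratio\<close>. The entry \<open>e\<^sub>i\<close> is \<open>e ! (i - 1)\<close>.\<close>

definition inv_seqs :: "(nat \<Rightarrow> nat) \<Rightarrow> nat \<Rightarrow> nat list set" where
  "inv_seqs s m = {e. length e = m \<and> (\<forall>i\<in>{1..m}. e ! (i - 1) < s i)}"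

definition inv_ratio :: "(nat \<Rightarrow> nat) \<Rightarrow> nat list \<Rightarrow> nat \<Rightarrow> rat" where
  "inv_ratio s e i = (if i = 0 then 0 / 1 else of_nat (e ! (i - 1)) / of_nat (s i))"

definition Asc :: "(nat \<Rightarrow> nat) \<Rightarrow> nat list \<Rightarrow> nat set" where
  "Asc s e = {i. i < length e \<and> inv_ratio s e i < inv_ratio s e (i + 1)}"

definition asc :: "(nat \<Rightarrow> nat) \<Rightarrow> nat list \<Rightarrow> nat" where
  "asc s e = card (Asc s e)"

definition s_prime :: "nat \<Rightarrow> nat" where
  "s_prime i = (if even i then i else 2 * i)"

lemma s_prime_even: "s_prime (2 * i) = 2 * i"
  by (simp add: s_prime_def)

lemma s_prime_odd: "i \<ge> 1 \<Longrightarrow> s_prime (2 * i - 1) = 4 * i - 2"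
  by (auto simp: s_prime_def)

definition I_prime :: "nat \<Rightarrow> nat list set" where
  "I_prime m = inv_seqs s_prime m"

lemma finite_signed_perms: "finite (signed_perms M)"
proof (rule finite_subset)
  let ?A = "set_mset M \<union> uminus ` set_mset M"
  show "signed_perms M \<subseteq> {\<sigma>. set \<sigma> \<subseteq> ?A \<and> length \<sigma> = size M}"
  proof
    fix \<sigma> assume "\<sigma> \<in> signed_perms M"
    then have M: "mset (map abs \<sigma>) = M" by (simp add: signed_perms_def)
    have "x \<in> ?A" if "x \<in> set \<sigma>" for x
    proof -
      have "\<bar>x\<bar> \<in> set_mset M" using that by (simp flip: M)
      then show ?thesis by (cases "x \<ge> 0") (auto simp: image_iff intro: bexI[of _ "- x"])
    qed
    moreover have "length \<sigma> = size M" by (simp flip: M)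
    ultimately show "\<sigma> \<in> {\<sigma>. set \<sigma> \<subseteq> ?A \<and> length \<sigma> = size M}" by blast
  qed
  show "finite {\<sigma>. set \<sigma> \<subseteq> ?A \<and> length \<sigma> = size M}"
    by (rule finite_lists_length_eq) simp
qed

lemma finite_inv_seqs: "finite (inv_seqs s m)"
proof (rule finite_subset)
  let ?A = "\<Union>i\<in>{1..m}. {..<s i}"
  show "inv_seqs s m \<subseteq> {e. set e \<subseteq> ?A \<and> length e = m}"
  proof
    fix e assume e: "e \<in> inv_seqs s m"
    have "x \<in> ?A" if x: "x \<in> set e" for x
    proof -
      obtain j where j: "j < m" "x = e ! j"
        using e x by (auto simp: inv_seqs_def in_set_conv_nth)
      then have "Suc j \<in> {1..m}" by simp
      moreover from this have "x < s (Suc j)"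
        using e j(2) by (metis (mono_tags, lifting) diff_Suc_1 inv_seqs_def mem_Collect_eq)
      ultimately show ?thesis by blast
    qed
    with e show "e \<in> {e. set e \<subseteq> ?A \<and> length e = m}" by (auto simp: inv_seqs_def)
  qed
  show "finite {e. set e \<subseteq> ?A \<and> length e = m}"
    by (rule finite_lists_length_eq) simp
qed

end

theory Submission
  imports Defs "HOL-Library.Product_Lexorder" "HOL-Computational_Algebra.Polynomial_FPS"
begin

text \<open>
  For both families \<open>x\<^bsup>stat\<^esup> / (1 - x)\<^bsup>m + 1\<^esup>\<close> enumerates, by the bound \<open>t\<close>, the weakly increasing
  assignments of levels \<open>0, \<dots>, t\<close> to the \<open>m\<close> letters that increase strictly at each descent
  (ascent). Hence it suffices that, for every \<open>t\<close>, as many levelled signed permutations as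
  levelled inversion sequences exist.

  The levelled letters of a signed permutation form a lexicographically sorted list, that is, a
  multiset: the copies of each \<open>k\<close> are chosen independently among \<open>2t + 1\<close> levelled letters, which gives
  \<open>(2t + 2 choose 2)\<^sup>n\<close> for \<open>P\<^sub>n\<close> and \<open>(2t + 2 choose 2)\<^bsup>n - 1\<^esup> (2t + 1)\<close> for \<open>U\<^sub>n\<close>.

  An inversion sequence \<open>e\<close> with levels \<open>c\<close> is the lecture hall sequence
  \<open>0 \<le> \<lambda>\<^sub>1/s\<^sub>1 \<le> \<dots> \<le> \<lambda>\<^sub>m/s\<^sub>m \<le> t\<close> with \<open>\<lambda>\<^sub>i/s\<^sub>i = c\<^sub>i - e\<^sub>i/s\<^sub>i\<close>. Counting these with the finer bound
  \<open>\<lambda>\<^sub>m \<le> N\<close> admits a product formula that depends only on the quotient and the remainder of \<open>N\<close>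
  and is verified by induction on \<open>m\<close> and \<open>N\<close>; it specialises to the same numbers.
\<close>

unbundle fps_syntax

section \<open>Levelled words and descents\<close>

fun desc :: "'a::linorder list \<Rightarrow> nat" where
  "desc (a # b # xs) = (if b < a then 1 else 0) + desc (b # xs)"
| "desc _ = 0"

abbreviation geom :: "int fps" where "geom \<equiv> Abs_fps (\<lambda>_. 1)"

text \<open>Pairs are (level, letter), ordered lexicographically.\<close>

definition chains :: "nat \<times> 'a::linorder \<Rightarrow> nat \<Rightarrow> (nat \<times> 'a) list set" where
  "chains p t = {w. sorted (p # w) \<and> (\<forall>x\<in>set w. fst x \<le> t)}"

lemma desc_eq_card: "desc xs = card {i. Suc i < length xs \<and> xs ! Suc i < xs ! i}"
proof (induction xs rule: desc.induct)
  case (1 a b xs)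
  let ?S = "{i. Suc i < length (b # xs) \<and> (b # xs) ! Suc i < (b # xs) ! i}"
  have "{i. Suc i < length (a # b # xs) \<and> (a # b # xs) ! Suc i < (a # b # xs) ! i}
      = (if b < a then {0} else {}) \<union> Suc ` ?S" (is "?L = ?R")
  proof (rule set_eqI)
    show "i \<in> ?L \<longleftrightarrow> i \<in> ?R" for i by (cases i) auto
  qed
  moreover have "card ?R = (if b < a then 1 else 0) + card ?S"
    by (subst card_Un_disjoint) (auto simp: card_image)
  ultimately show ?case using 1 by simp
qed auto

lemma desc_snoc: "desc (xs @ [a, b]) = desc (xs @ [a]) + (if b < a then 1 else 0)"
proof (induction xs)
  case (Cons x xs) then show ?case by (cases xs) auto
qed auto

text \<open>Reversal swaps the two letters of every adjacent pair and negation swaps their order, so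
  descents correspond to descents.\<close>

lemma desc_rev_uminus: "desc (rev (map uminus xs)) = desc (xs :: int list)"
proof (induction xs rule: desc.induct)
  case (1 a b xs)
  then show ?case by (simp add: desc_snoc)
qed auto

lemma geom_mult_nth: "(geom * F) $ n = (\<Sum>i\<le>n. F $ (n - i))"
  by (simp add: fps_mult_nth atLeast0AtMost)

text \<open>Induction peels off the first level \<open>c\<close>. Summing over the possible
  \<open>c\<close> is multiplication by \<open>geom\<close>, and a descent from \<open>b\<close> to
  the first letter raises the least admissible \<open>c\<close> by one, which contributes a factor
  \<open>fps_X\<close>. Finiteness is carried along for the cardinality of the disjoint
  union.\<close>

lemma chains_with_word:
  fixes b :: "'a::linorder"
  assumes "c0 \<le> t"
  shows "finite {w \<in> chains (c0, b) t. map snd w = \<tau>} \<and>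
    int (card {w \<in> chains (c0, b) t. map snd w = \<tau>})
      = (geom ^ Suc (length \<tau>) * fps_X ^ desc (b # \<tau>)) $ (t - c0)"
  using assms
proof (induction \<tau> arbitrary: b c0)
  case Nil
  have "{w \<in> chains (c0, b) t. map snd w = []} = {[]}" by (auto simp: chains_def)
  then show ?case by simp
next
  case (Cons a \<tau>)
  define \<delta> :: nat where "\<delta> = (if a < b then 1 else 0)"
  define F where "F = geom ^ Suc (length \<tau>) * fps_X ^ desc (a # \<tau>)"
  define C where "C c = {w \<in> chains (c, a) t. map snd w = \<tau>}" for c
  have eq: "{w \<in> chains (c0, b) t. map snd w = a # \<tau>} = (\<Union>c\<in>{c0 + \<delta>..t}. (#) (c, a) ` C c)"
    (is "?L = ?R")
  proof (rule set_eqI)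
    fix w
    show "w \<in> ?L \<longleftrightarrow> w \<in> ?R"
    proof (cases w)
      case (Cons p v)
      obtain c a' where p: "p = (c, a')" by (cases p)
      have "(c0, b) \<le> (c, a) \<longleftrightarrow> c0 + \<delta> \<le> c" by (auto simp: \<delta>_def less_eq_prod_def)
      moreover have "(c0, b) \<le> x" if "(c0, b) \<le> (c, a)" "(c, a) \<le> x" for x
        using that by (rule order_trans)
      ultimately show ?thesis using Cons p by (auto simp: C_def chains_def)
    qed auto
  qed
  have fin: "finite (C c)" and card: "int (card (C c)) = F $ (t - c)" if "c \<le> t" for c
    using Cons.IH[OF that, of a] by (simp_all add: C_def F_def)
  have "card ?L = (\<Sum>c\<in>{c0 + \<delta>..t}. card ((#) (c, a) ` C c))"
    unfolding eq by (rule card_UN_disjoint) (use fin in auto)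
  also have "\<dots> = (\<Sum>c\<in>{c0 + \<delta>..t}. card (C c))"
    by (intro sum.cong refl card_image) (auto simp: inj_on_def)
  finally have "int (card ?L) = (\<Sum>c\<in>{c0 + \<delta>..t}. F $ (t - c))"
    using card by simp
  also have "\<dots> = (fps_X ^ \<delta> * (geom * F)) $ (t - c0)"
  proof (cases "c0 + \<delta> \<le> t")
    case True
    have "(\<Sum>c\<in>{c0 + \<delta>..t}. F $ (t - c)) = (\<Sum>i\<le>t - c0 - \<delta>. F $ (t - c0 - \<delta> - i))"
      by (rule sum.reindex_bij_witness[of _ "\<lambda>i. i + c0 + \<delta>" "\<lambda>c. c - c0 - \<delta>"]) (use True in auto)
    then show ?thesis using True by (simp add: fps_X_power_mult_nth geom_mult_nth)
  \<comment> \<open>Here \<open>t - c0\<close> is smaller than \<open>\<delta>\<close>: the sum is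
    empty and the coefficient vanishes.\<close>
  qed (use Cons.prems in \<open>simp add: fps_X_power_mult_nth\<close>)
  also have "fps_X ^ \<delta> * (geom * F) = geom ^ Suc (length (a # \<tau>)) * fps_X ^ desc (b # a # \<tau>)"
    by (simp add: F_def \<delta>_def power_add mult_ac)
  finally show ?case using fin by (auto simp: eq)
qed

lemma chains_with_words:
  assumes "finite T" and "\<And>\<tau>. \<tau> \<in> T \<Longrightarrow> length \<tau> = m"
  shows "geom ^ Suc m * fps_of_poly (\<Sum>\<tau>\<in>T. monom 1 (desc (b # \<tau>)))
    = Abs_fps (\<lambda>t. int (card {w \<in> chains (0, b) t. map snd w \<in> T}))"
proof (rule fps_ext)
  fix t
  have "{w \<in> chains (0, b) t. map snd w \<in> T} = (\<Union>\<tau>\<in>T. {w \<in> chains (0, b) t. map snd w = \<tau>})"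
    by auto
  also have "int (card \<dots>) = (\<Sum>\<tau>\<in>T. int (card {w \<in> chains (0, b) t. map snd w = \<tau>}))"
    by (subst card_UN_disjoint) (use assms chains_with_word[of 0 t b] in auto)
  also have "\<dots> = (\<Sum>\<tau>\<in>T. (geom ^ Suc m * fps_X ^ desc (b # \<tau>)) $ t)"
    using assms(2) chains_with_word[of 0 t b] by (intro sum.cong) auto
  also have "\<dots> = (geom ^ Suc m * fps_of_poly (\<Sum>\<tau>\<in>T. monom 1 (desc (b # \<tau>)))) $ t"
    by (simp add: fps_of_poly_sum fps_of_poly_monom' sum_distrib_left fps_sum_nth)
  finally show "(geom ^ Suc m * fps_of_poly (\<Sum>\<tau>\<in>T. monom 1 (desc (b # \<tau>)))) $ t
    = Abs_fps (\<lambda>t. int (card {w \<in> chains (0, b) t. map snd w \<in> T})) $ t" by simp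
qed

text \<open>Equal counts for all \<open>t\<close> give equal power series, and the nonzero factor
  \<open>geom ^ Suc m\<close> cancels over the integers. The two letter types may differ; they will
  be integers and rationals.\<close>

lemma desc_distribution_eqI:
  assumes "finite T" "\<And>\<tau>. \<tau> \<in> T \<Longrightarrow> length \<tau> = m"
    and "finite T'" "\<And>\<tau>. \<tau> \<in> T' \<Longrightarrow> length \<tau> = m"
    and "\<And>t. card {w \<in> chains (0, b) t. map snd w \<in> T} = card {w \<in> chains (0, b') t. map snd w \<in> T'}"
  shows "(\<Sum>\<tau>\<in>T. monom (1::int) (desc (b # \<tau>))) = (\<Sum>\<tau>\<in>T'. monom 1 (desc (b' # \<tau>)))"
proof -
  have "geom ^ Suc m * fps_of_poly (\<Sum>\<tau>\<in>T. monom 1 (desc (b # \<tau>)))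
      = geom ^ Suc m * fps_of_poly (\<Sum>\<tau>\<in>T'. monom 1 (desc (b' # \<tau>)))"
    using assms by (simp only: chains_with_words)
  moreover have "geom \<noteq> 0" by (metis fps_nth_Abs_fps fps_zero_nth zero_neq_one)
  ultimately show ?thesis by (simp add: fps_of_poly_eq_iff del: power_Suc)
qed

section \<open>Signed permutations\<close>

text \<open>The descent at \<open>m\<close> compares \<open>\<sigma>\<^sub>m\<close> with an appended letter \<open>0\<close>; reversing and negating
  moves that letter to the front and preserves descents.\<close>

lemma des_B_eq_desc: "des_B \<sigma> = desc (0 # map uminus (rev \<sigma>))"
proof -
  have "bij_betw Suc {i. Suc i < length (\<sigma> @ [0]) \<and> (\<sigma> @ [0]) ! Suc i < (\<sigma> @ [0]) ! i} (Des_B \<sigma>)"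
  proof (rule bij_betw_byWitness[where f' = "\<lambda>i. i - 1"])
  qed (auto simp: Des_B_def nth_append split: if_splits)
  then have "des_B \<sigma> = desc (\<sigma> @ [0])"
    unfolding des_B_def desc_eq_card by (rule bij_betw_same_card[symmetric])
  also have "\<dots> = desc (rev (map uminus (\<sigma> @ [0])))" by (simp only: desc_rev_uminus)
  finally show ?thesis by (simp add: rev_map)
qed

text \<open>Reversal with negation is an involution of \<open>signed_perms M\<close>, as it keeps
  the absolute values.\<close>

lemma sum_des_B:
  "(\<Sum>\<sigma>\<in>signed_perms M. monom (1::int) (des_B \<sigma>))
     = (\<Sum>\<tau>\<in>signed_perms M. monom 1 (desc (0 # \<tau>)))"
  by (rule sum.reindex_bij_witness[of _ "\<lambda>\<tau>. map uminus (rev \<tau>)" "\<lambda>\<tau>. map uminus (rev \<tau>)"])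
    (auto simp: des_B_eq_desc signed_perms_def rev_map multiset.map_comp comp_def)

section \<open>Counting multisets of levelled letters\<close>

definition msets_over :: "'a set \<Rightarrow> ('a \<Rightarrow> 'b) \<Rightarrow> 'b multiset \<Rightarrow> 'a multiset set" where
  "msets_over A f M = {K. set_mset K \<subseteq> A \<and> image_mset f K = M}"

text \<open>A sorted list is determined by its multiset, and the remaining conditions depend only on
  that multiset.\<close>

lemma card_chains_signed_perms:
  "card {w \<in> chains (0, 0) t. map snd w \<in> signed_perms M}
    = card (msets_over {p. (0, 0) \<le> p \<and> fst p \<le> t} (\<lambda>p. \<bar>snd p\<bar>) M)"
proof (rule bij_betw_same_card[of mset])
  show "bij_betw mset {w \<in> chains (0, 0) t. map snd w \<in> signed_perms M}
    (msets_over {p. (0, 0) \<le> p \<and> fst p \<le> t} (\<lambda>p. \<bar>snd p\<bar>) M)"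
    by (rule bij_betw_byWitness[where f' = sorted_list_of_multiset])
      (auto simp: chains_def msets_over_def signed_perms_def multiset.map_comp comp_def sorted_sort_id)
qed


text \<open>As \<open>k\<close> does not occur in \<open>M\<close>, the elements over
  \<open>k\<close> are chosen independently of the others: they form any multiset of size
  \<open>p\<close> on the fibre, counted by stars and bars.\<close>

lemma card_msets_over_add:
  assumes "k \<notin># M" and "finite {x \<in> A. f x = k}"
  shows "card (msets_over A f (M + replicate_mset p k))
    = card (msets_over A f M) * ((card {x \<in> A. f x = k} + p - 1) choose p)"
proof -
  have "bij_betw (\<lambda>K. (filter_mset (\<lambda>x. f x \<noteq> k) K, filter_mset (\<lambda>x. f x = k) K))
    (msets_over A f (M + replicate_mset p k)) (msets_over A f M \<times> multisets_of_size {x \<in> A. f x = k} p)"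
  proof (rule bij_betw_byWitness[where f' = "\<lambda>(K, L). K + L"], goal_cases)
    case 1
    show ?case by (simp add: union_filter_mset_complement)
  next
    case 2
    have "filter_mset (\<lambda>x. f x \<noteq> k) K = K" "filter_mset (\<lambda>x. f x = k) K = {#}"
      if "K \<in> msets_over A f M" for K
      using assms(1) that by (auto simp: msets_over_def filter_mset_eq_conv)
    moreover have "filter_mset (\<lambda>x. f x \<noteq> k) L = {#}" "filter_mset (\<lambda>x. f x = k) L = L"
      if "L \<in> multisets_of_size {x \<in> A. f x = k} p" for L
      using that by (auto simp: multisets_of_size_def filter_mset_eq_conv)
    ultimately show ?case by auto
  next
    case 3
    have M: "filter_mset (\<lambda>y. y \<noteq> k) M = M" "filter_mset (\<lambda>y. y = k) M = {#}"
      "filter_mset (\<lambda>y. y \<noteq> k) (replicate_mset p k) = {#}"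
      "filter_mset (\<lambda>y. y = k) (replicate_mset p k) = replicate_mset p k"
      using assms(1) by (auto simp: filter_mset_eq_conv)
    have "image_mset f (filter_mset (\<lambda>x. f x \<noteq> k) K) = M \<and> size (filter_mset (\<lambda>x. f x = k) K) = p"
      if "image_mset f K = M + replicate_mset p k" for K
    proof -
      have "image_mset f (filter_mset (\<lambda>x. P (f x)) K)
          = filter_mset P (M + replicate_mset p k)" for P
        by (simp flip: that add: filter_mset_image_mset)
      from this[of "\<lambda>y. y \<noteq> k"] this[of "\<lambda>y. y = k"] M
      have 1: "image_mset f (filter_mset (\<lambda>x. f x \<noteq> k) K) = M"
        and 2: "image_mset f (filter_mset (\<lambda>x. f x = k) K) = replicate_mset p k"
        by simp_all
      show ?thesis using 1 arg_cong[OF 2, of size] by simp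
    qed
    then show ?case by (auto simp: msets_over_def multisets_of_size_def)
  next
    case 4
    have "image_mset f L = replicate_mset p k" if "L \<in> multisets_of_size {x \<in> A. f x = k} p" for L
    proof -
      have "image_mset f L = image_mset (\<lambda>_. k) L"
        using that by (intro image_mset_cong) (auto simp: multisets_of_size_def)
      then show ?thesis using that by (simp add: multisets_of_size_def image_mset_const_eq)
    qed
    then show ?case by (auto simp: msets_over_def multisets_of_size_def)
  qed
  then show ?thesis
    using assms(2) by (simp add: bij_betw_same_card card_cartesian_product card_multisets_of_size)
qed

definition letters :: "nat \<Rightarrow> (nat \<times> int) set" where
  "letters t = {p. (0, 0) \<le> p \<and> fst p \<le> t}"

text \<open>Level 0 admits only the positive letter, since \<open>(0, 0) \<le> (0, - k)\<close>
  fails; each of the levels 1 to \<open>t\<close> admits both signs.\<close>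

lemma card_letters_abs:
  assumes "k > 0"
  shows "card {p \<in> letters t. \<bar>snd p\<bar> = k} = 2 * t + 1" "finite {p \<in> letters t. \<bar>snd p\<bar> = k}"
proof -
  have eq: "{p \<in> letters t. \<bar>snd p\<bar> = k} = insert (0, k) ({1..t} \<times> {k, - k})"
    using assms by (auto simp: letters_def less_eq_prod_def)
  show "card {p \<in> letters t. \<bar>snd p\<bar> = k} = 2 * t + 1" "finite {p \<in> letters t. \<bar>snd p\<bar> = k}"
    unfolding eq using assms by (simp_all add: card_insert_if)
qed

text \<open>Triangular numbers: the number of multisets of size 2 on \<open>q + 1\<close>
  elements.\<close>

definition tri :: "nat \<Rightarrow> nat" where "tri q = (q + 2) choose 2"

lemma card_msets_over_P:
  "card (msets_over (letters t) (\<lambda>p. \<bar>snd p\<bar>) (\<Sum>k\<in>{1..n}. replicate_mset 2 (int k))) = tri (2 * t) ^ n"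
proof (induction n)
  case 0
  have "msets_over (letters t) (\<lambda>p. \<bar>snd p\<bar>) {#} = {{#}}" by (auto simp: msets_over_def)
  then show ?case by simp
next
  case (Suc n)
  have "int (Suc n) \<notin># (\<Sum>k\<in>{1..n}. replicate_mset 2 (int k))" by (auto simp: set_mset_sum)
  then show ?case
    using Suc card_letters_abs[of "int (Suc n)" t] by (simp add: card_msets_over_add tri_def del: of_nat_Suc)
qed

lemma card_msets_over_U:
  "card (msets_over (letters t) (\<lambda>p. \<bar>snd p\<bar>)
    ((\<Sum>k\<in>{1..n}. replicate_mset 2 (int k)) + {#int (Suc n)#})) = tri (2 * t) ^ n * (2 * t + 1)"
proof -
  have "int (Suc n) \<notin># (\<Sum>k\<in>{1..n}. replicate_mset 2 (int k))" by (auto simp: set_mset_sum)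
  then show ?thesis
    using card_msets_over_P[of t n] card_letters_abs[of "int (Suc n)" t]
      card_msets_over_add[of "int (Suc n)" _ "letters t" "\<lambda>p. \<bar>snd p\<bar>" 1]
    by (simp del: of_nat_Suc)
qed

section \<open>Inversion sequences\<close>

text \<open>Storing the ratios rather than their numerators turns the lecture hall condition into
  plain sortedness; \<open>of_nat j\<close> enforces nonnegativity.\<close>

definition lecture_hall :: "(nat \<Rightarrow> nat) \<Rightarrow> nat \<Rightarrow> rat \<Rightarrow> rat list set" where
  "lecture_hall s m q = {\<mu>. length \<mu> = m \<and> sorted \<mu> \<and> (\<forall>x\<in>set \<mu>. x \<le> q) \<and>
     (\<forall>i<m. \<exists>j. \<mu> ! i = of_nat j / of_nat (s (Suc i)))}"

text \<open>The value \<open>s 0\<close> is irrelevant, since \<open>lh_count s 0\<close> is constant.\<close>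

primrec lh_count :: "(nat \<Rightarrow> nat) \<Rightarrow> nat \<Rightarrow> nat \<Rightarrow> nat" where
  "lh_count s 0 N = 1"
| "lh_count s (Suc m) N = (\<Sum>j\<le>N. lh_count s m (j * s m div s (Suc m)))"

lemma lecture_hall_Suc:
  assumes "s (Suc m) > 0"
  shows "lecture_hall s (Suc m) (of_nat N / of_nat (s (Suc m)))
    = (\<Union>j\<le>N. (\<lambda>\<mu>. \<mu> @ [of_nat j / of_nat (s (Suc m))]) ` lecture_hall s m (of_nat j / of_nat (s (Suc m))))"
    (is "?L = ?R")
proof (rule set_eqI)
  fix \<mu>
  show "\<mu> \<in> ?L \<longleftrightarrow> \<mu> \<in> ?R"
  proof (cases \<mu> rule: rev_cases)
    case (snoc v x)
    have le: "of_nat j / of_nat (s (Suc m)) \<le> (of_nat N / of_nat (s (Suc m)) :: rat) \<longleftrightarrow> j \<le> N" for j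
      using assms by (simp add: divide_le_cancel)
    show ?thesis
    proof
      assume L: "\<mu> \<in> ?L"
      then have len: "length v = m" by (simp add: lecture_hall_def snoc)
      from L have "\<exists>j. \<mu> ! m = of_nat j / of_nat (s (Suc m))" by (simp add: lecture_hall_def)
      then obtain j where "\<mu> ! m = of_nat j / of_nat (s (Suc m))" ..
      with len have j: "x = of_nat j / of_nat (s (Suc m))" by (simp add: snoc nth_append)
      with L have "j \<le> N" by (auto simp: lecture_hall_def snoc le)
      moreover have "\<exists>j. v ! i = of_nat j / of_nat (s (Suc i))" if "i < m" for i
        using L that len by (auto simp: lecture_hall_def snoc nth_append dest: spec[of _ i])
      with L len have "v \<in> lecture_hall s m x" by (auto simp: lecture_hall_def snoc sorted_append)
      ultimately show "\<mu> \<in> ?R" using snoc j by auto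
    next
      assume "\<mu> \<in> ?R"
      then obtain j where j: "j \<le> N" "x = of_nat j / of_nat (s (Suc m))" "v \<in> lecture_hall s m x"
        by (auto simp: snoc)
      have "x \<le> of_nat N / of_nat (s (Suc m))" using j le by simp
      with j show "\<mu> \<in> ?L"
        by (force simp: lecture_hall_def snoc sorted_append nth_append less_Suc_eq)
    qed
  qed (auto simp: lecture_hall_def)
qed

text \<open>Only the last entry, the largest, has to be bounded. It is a multiple of
  \<open>1 / s m\<close>, so the bound may be rounded down to such a multiple.\<close>

lemma lecture_hall_bound_floor:
  assumes "s m > 0" "s' > 0" "m > 0"
  shows "lecture_hall s m (of_nat j / of_nat s') = lecture_hall s m (of_nat (j * s m div s') / of_nat (s m))"
proof -
  have le: "of_nat k / of_nat (s m) \<le> (of_nat j / of_nat s' :: rat) \<longleftrightarrow>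
     of_nat k / of_nat (s m) \<le> (of_nat (j * s m div s') / of_nat (s m) :: rat)" for k
  proof -
    have "of_nat k / of_nat (s m) \<le> (of_nat j / of_nat s' :: rat) \<longleftrightarrow> of_nat (k * s') \<le> (of_nat (j * s m) :: rat)"
      using assms by (simp add: field_simps)
    also have "\<dots> \<longleftrightarrow> k \<le> j * s m div s'"
      using assms by (simp only: of_nat_le_iff less_eq_div_iff_mult_less_eq)
    finally show ?thesis using assms by (simp add: divide_le_cancel)
  qed
  have "(\<forall>x\<in>set \<mu>. x \<le> of_nat j / of_nat s') \<longleftrightarrow> (\<forall>x\<in>set \<mu>. x \<le> of_nat (j * s m div s') / of_nat (s m))"
    if "length \<mu> = m" "sorted \<mu>" "\<forall>i<m. \<exists>j. \<mu> ! i = of_nat j / of_nat (s (Suc i))" for \<mu> :: "rat list"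
  proof -
    have "\<mu> \<noteq> []" using that(1) assms(3) by auto
    then obtain v x where \<mu>: "\<mu> = v @ [x]" by (meson rev_exhaust)
    with that(1) have m: "m = Suc (length v)" by simp
    with that(3) have "\<exists>i. \<mu> ! length v = of_nat i / of_nat (s m)" by blast
    then obtain i where "x = of_nat i / of_nat (s m)" by (auto simp: \<mu>)
    moreover have "(\<forall>y\<in>set \<mu>. y \<le> b) \<longleftrightarrow> x \<le> b" for b
      using that(2) by (auto simp: \<mu> sorted_append intro: order_trans)
    ultimately show ?thesis using le by simp
  qed
  then show ?thesis unfolding lecture_hall_def by blast
qed

text \<open>The recursion of \<open>lh_count\<close> splits off the last entry, which bounds the
  rest, and rounds that bound down to denominator \<open>s m\<close>.\<close>

lemma card_lecture_hall:
  assumes "\<And>i. i > 0 \<Longrightarrow> s i > 0"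
  shows "finite (lecture_hall s m (of_nat N / of_nat (s m))) \<and>
    card (lecture_hall s m (of_nat N / of_nat (s m))) = lh_count s m N"
proof (induction m arbitrary: N)
  case 0
  have "lecture_hall s 0 q = {[]}" for q by (auto simp: lecture_hall_def)
  then show ?case by simp
next
  case (Suc m)
  define S where "S j = lecture_hall s m (of_nat j / of_nat (s (Suc m)))" for j
  have S: "finite (S j) \<and> card (S j) = lh_count s m (j * s m div s (Suc m))" for j
  \<comment> \<open>Rounding divides by \<open>s m\<close>, and \<open>s 0\<close> may be
    zero.\<close>
  proof (cases "m = 0")
    case True
    then have "S j = {[]}" by (auto simp: lecture_hall_def S_def)
    with True show ?thesis by simp
  next
    case False
    then have "S j = lecture_hall s m (of_nat (j * s m div s (Suc m)) / of_nat (s m))"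
      unfolding S_def using assms by (intro lecture_hall_bound_floor) auto
    with Suc show ?thesis by simp
  qed
  have pos: "s (Suc m) > 0" using assms by simp
  have "card (lecture_hall s (Suc m) (of_nat N / of_nat (s (Suc m))))
    = (\<Sum>j\<le>N. card ((\<lambda>\<mu>. \<mu> @ [of_nat j / of_nat (s (Suc m))]) ` S j))"
    unfolding lecture_hall_Suc[of s m, OF pos] S_def[symmetric] by (rule card_UN_disjoint) (use S pos in auto)
  also have "\<dots> = (\<Sum>j\<le>N. card (S j))"
    by (intro sum.cong refl card_image) (auto simp: inj_on_def)
  finally show ?case
    using S lecture_hall_Suc[of s m, OF pos] by (simp add: S_def)
qed

section \<open>Inversion sequences as words with letters in (-1, 0]\<close>

text \<open>The sign turns ascents of the ratios into descents; a letter 0 put in front plays the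
  part of the initial ratio 0/1.\<close>

definition inv_word :: "(nat \<Rightarrow> nat) \<Rightarrow> nat list \<Rightarrow> rat list" where
  "inv_word s e = map (\<lambda>i. - inv_ratio s e (Suc i)) [0..<length e]"

lemma desc_inv_word: "desc (0 # inv_word s e) = asc s e"
proof -
  have "(0 # inv_word s e) ! i = - inv_ratio s e i" if "i \<le> length e" for i
    using that by (cases i) (auto simp: inv_word_def inv_ratio_def)
  then have "{i. Suc i < length (0 # inv_word s e) \<and> (0 # inv_word s e) ! Suc i < (0 # inv_word s e) ! i}
    = Asc s e" by (auto simp: Asc_def inv_word_def)
  then show ?thesis by (simp add: desc_eq_card asc_def)
qed

lemma inj_on_inv_word:
  assumes "\<And>i. i > 0 \<Longrightarrow> s i > 0"
  shows "inj_on (inv_word s) (inv_seqs s m)"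
proof (rule inj_onI, rule nth_equalityI)
  fix e e' assume *: "e \<in> inv_seqs s m" "e' \<in> inv_seqs s m" "inv_word s e = inv_word s e'"
  then show len: "length e = length e'" by (simp add: inv_seqs_def)
  fix i assume "i < length e"
  then have "inv_word s e ! i = - (of_nat (e ! i) / of_nat (s (Suc i)))"
    "inv_word s e' ! i = - (of_nat (e' ! i) / of_nat (s (Suc i)))"
    using len by (simp_all add: inv_word_def inv_ratio_def)
  then show "e ! i = e' ! i" using * assms[of "Suc i"] by simp
qed

lemma inv_word_image_iff:
  assumes "\<And>i. i > 0 \<Longrightarrow> s i > 0"
  shows "\<tau> \<in> inv_word s ` inv_seqs s m \<longleftrightarrow> length \<tau> = m \<and>
    (\<forall>i<m. \<exists>k<s (Suc i). \<tau> ! i = - (of_nat k / of_nat (s (Suc i))))" (is "_ \<longleftrightarrow> ?R")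
proof
  assume "\<tau> \<in> inv_word s ` inv_seqs s m"
  then show ?R by (force simp: inv_word_def inv_seqs_def inv_ratio_def)
next
  assume R: ?R
  then obtain k where k: "\<And>i. i < m \<Longrightarrow> k i < s (Suc i) \<and> \<tau> ! i = - (of_nat (k i) / of_nat (s (Suc i)))"
    by metis
  have "k (i - 1) < s i" if "i \<in> {1..m}" for i using k[of "i - 1"] that by auto
  then have "map k [0..<m] \<in> inv_seqs s m" by (auto simp: inv_seqs_def)
  moreover have "\<tau> = inv_word s (map k [0..<m])"
    using R k by (intro nth_equalityI) (auto simp: inv_word_def inv_ratio_def)
  ultimately show "\<tau> \<in> inv_word s ` inv_seqs s m" by blast
qed

text \<open>Splitting a rational \<open>x \<ge> 0\<close> into its ceiling and \<open>x - \<lceil>x\<rceil> \<in> (-1, 0]\<close> is an order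
  isomorphism onto the lexicographic order, so it matches lecture hall sequences with chains.\<close>

lemma card_chains_inv_word:
  assumes "\<And>i. i > 0 \<Longrightarrow> s i > 0"
  shows "card {w \<in> chains (0, 0) t. map snd w \<in> inv_word s ` inv_seqs s m} = card (lecture_hall s m (of_nat t))"
    (is "card ?W = _")
proof -
  define \<psi> where "\<psi> = (\<lambda>(c :: nat, \<rho> :: rat). of_nat c + \<rho>)"
  define \<phi> where "\<phi> x = (nat \<lceil>x\<rceil>, x - of_int \<lceil>x\<rceil>)" for x :: rat
  have W: "p \<in> set w \<Longrightarrow> - 1 < snd p \<and> snd p \<le> 0 \<and> (0, 0) \<le> p \<and> fst p \<le> t" if "w \<in> ?W" for w p
  proof -
    assume "p \<in> set w"
    then obtain i where i: "i < length w" "p = w ! i" by (auto simp: in_set_conv_nth)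
    from that have "length w = m" "\<forall>i<m. \<exists>k<s (Suc i). map snd w ! i = - (of_nat k / of_nat (s (Suc i)))"
      by (auto simp: inv_word_image_iff[OF assms] simp del: nth_map)
    with i obtain k where "k < s (Suc i)" "snd p = - (of_nat k / of_nat (s (Suc i)))" by auto
    then show ?thesis using that \<open>p \<in> set w\<close> by (auto simp: chains_def)
  qed
  have LH: "x \<in> set \<mu> \<Longrightarrow> 0 \<le> x \<and> x \<le> of_nat t" if "\<mu> \<in> lecture_hall s m (of_nat t)" for \<mu> x
    using that by (fastforce simp: lecture_hall_def in_set_conv_nth)
  have \<psi>\<phi>: "\<psi> (\<phi> x) = x" if "0 \<le> x" for x using that by (simp add: \<psi>_def \<phi>_def)
  have ceil: "\<lceil>of_nat c + r\<rceil> = int c" if "- 1 < r" "r \<le> 0" for c and r :: rat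
    using that by (simp add: ceiling_eq_iff)
  have \<phi>\<psi>: "\<phi> (\<psi> p) = p" if "- 1 < snd p" "snd p \<le> 0" for p
    using that by (cases p) (simp add: \<psi>_def \<phi>_def ceil)
  \<comment> \<open>A rise in level is at least 1, while the letters can lower the value by less
    than 1.\<close>
  have mono_\<psi>: "\<psi> p \<le> \<psi> p'" if "p \<le> p'" "- 1 < snd p'" "snd p \<le> 0" for p p'
  proof (cases "fst p < fst p'")
    case True
    then have "of_nat (fst p) + 1 \<le> (of_nat (fst p') :: rat)" by (metis Suc_eq_plus1 Suc_leI of_nat_Suc of_nat_le_iff add.commute)
    then show ?thesis using that by (auto simp: \<psi>_def split: prod.splits)
  qed (use that in \<open>auto simp: \<psi>_def less_eq_prod_def split: prod.splits\<close>)
  have mono_\<phi>: "\<phi> x \<le> \<phi> y" if "x \<le> y" "0 \<le> x" for x y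
  proof (cases "\<lceil>x\<rceil> = \<lceil>y\<rceil>")
    case False
    then have "\<lceil>x\<rceil> < \<lceil>y\<rceil>" using ceiling_mono[OF that(1)] by simp
    moreover have "0 \<le> \<lceil>x\<rceil>" using that(2) by simp
    ultimately have "nat \<lceil>x\<rceil> < nat \<lceil>y\<rceil>" by linarith
    then show ?thesis by (simp add: \<phi>_def less_eq_prod_def)
  qed (use that in \<open>simp add: \<phi>_def less_eq_prod_def\<close>)
  have "bij_betw (map \<psi>) ?W (lecture_hall s m (of_nat t))"
  proof (rule bij_betw_byWitness[where f' = "map \<phi>"])
    show "\<forall>w\<in>?W. map \<phi> (map \<psi> w) = w" 
    proof
      fix w assume "w \<in> ?W"
      from W[OF this] show "map \<phi> (map \<psi> w) = w" unfolding map_map by (intro map_idI) (simp add: \<phi>\<psi>)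
    qed
    show "\<forall>\<mu>\<in>lecture_hall s m (of_nat t). map \<psi> (map \<phi> \<mu>) = \<mu>" using LH \<psi>\<phi> by (auto intro!: map_idI)
    show "map \<psi> ` ?W \<subseteq> lecture_hall s m (of_nat t)"
    proof (rule image_subsetI)
      fix w assume w: "w \<in> ?W"
      then have w': "length w = m" "\<forall>i<m. \<exists>k<s (Suc i). snd (w ! i) = - (of_nat k / of_nat (s (Suc i)))"
        by (auto simp: inv_word_image_iff[OF assms])
      have "sorted (map \<psi> w)"
      proof -
        have "sorted w" using w by (simp add: chains_def)
        then show ?thesis unfolding sorted_map
          by (rule sorted_wrt_mono_rel[rotated]) (use W[OF w] mono_\<psi> in blast)
      qed
      moreover have "\<psi> p \<le> of_nat t" if "p \<in> set w" for p
        using W[OF w that] by (cases p) (auto simp: \<psi>_def intro: add_mono[of _ _ _ "0::rat", simplified])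
      moreover have "\<exists>j. \<psi> (w ! i) = of_nat j / of_nat (s (Suc i))" if i: "i < m" for i
      proof -
        obtain k where k: "k < s (Suc i)" "snd (w ! i) = - (of_nat k / of_nat (s (Suc i)))"
          using w' i by blast
        obtain c \<rho> where p: "w ! i = (c, \<rho>)" by fastforce
        have "(0, 0) \<le> w ! i" using W[OF w] i w'(1) by simp
        \<comment> \<open>At level 0 the chain excludes negative letters, so the numerator
          \<open>c * s (Suc i) - k\<close> below is not truncated.\<close>
        then have "c > 0 \<or> k = 0" using k p by (auto simp: less_eq_prod_def divide_le_0_iff)
        then have "k \<le> c * s (Suc i)" using k(1)
          by (metis le_trans less_imp_le_nat mult_le_mono1 nat_mult_1 Suc_leI One_nat_def zero_le)
        then have "\<psi> (w ! i) = of_nat (c * s (Suc i) - k) / of_nat (s (Suc i))"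
          using k p assms[of "Suc i"] by (simp add: \<psi>_def of_nat_diff field_simps)
        then show ?thesis ..
      qed
      ultimately show "map \<psi> w \<in> lecture_hall s m (of_nat t)"
        using w'(1) by (auto simp: lecture_hall_def)
    qed
    show "map \<phi> ` lecture_hall s m (of_nat t) \<subseteq> ?W"
    proof (rule image_subsetI)
      fix \<mu> assume \<mu>: "\<mu> \<in> lecture_hall s m (of_nat t)"
      have "sorted (map \<phi> \<mu>)"
      proof -
        have "sorted \<mu>" using \<mu> by (simp add: lecture_hall_def)
        then show ?thesis unfolding sorted_map
          by (rule sorted_wrt_mono_rel[rotated]) (use LH[OF \<mu>] mono_\<phi> in blast)
      qed
      moreover have "(0, 0) \<le> \<phi> x" if "x \<in> set \<mu>" for x
        using mono_\<phi>[of 0 x] LH[OF \<mu> that] by (simp add: \<phi>_def)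
      moreover have "fst (\<phi> x) \<le> t" if "x \<in> set \<mu>" for x
        using LH[OF \<mu> that] by (simp add: \<phi>_def ceiling_le_iff nat_le_iff)
      ultimately have "map \<phi> \<mu> \<in> chains (0, 0) t" by (auto simp: chains_def)
      moreover have "\<exists>k<s (Suc i). snd (\<phi> (\<mu> ! i)) = - (of_nat k / of_nat (s (Suc i)))" if i: "i < m" for i
      proof -
        obtain j where j: "\<mu> ! i = of_nat j / of_nat (s (Suc i))"
          using \<mu> i by (auto simp: lecture_hall_def)
        define c where "c = nat \<lceil>\<mu> ! i\<rceil>"
        have "0 \<le> \<mu> ! i" using j by simp
        then have c: "of_nat c = (of_int \<lceil>\<mu> ! i\<rceil> :: rat)" by (simp add: c_def)
        have pos: "0 < (of_nat (s (Suc i)) :: rat)" using assms by simp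
        \<comment> \<open>Scaled by \<open>s (Suc i)\<close>, these bounds on the ceiling place the
          witness \<open>c * s (Suc i) - j\<close> between 0 and
          \<open>s (Suc i) - 1\<close>.\<close>
        have "of_nat c - 1 < \<mu> ! i" "\<mu> ! i \<le> of_nat c" unfolding c by linarith+
        then have "of_nat (c * s (Suc i)) < (of_nat (j + s (Suc i)) :: rat)"
            "of_nat j \<le> (of_nat (c * s (Suc i)) :: rat)"
          using pos by (simp_all add: j field_simps)
        then have "c * s (Suc i) < j + s (Suc i)" "j \<le> c * s (Suc i)" by (simp_all only: of_nat_less_iff of_nat_le_iff)
        moreover from this have "snd (\<phi> (\<mu> ! i)) = - (of_nat (c * s (Suc i) - j) / of_nat (s (Suc i)))"
          using pos by (simp add: \<phi>_def flip: c) (simp add: j of_nat_diff field_simps)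
        ultimately show ?thesis by (intro exI[of _ "c * s (Suc i) - j"]) auto
      qed
      ultimately show "map \<phi> \<mu> \<in> ?W"
        using \<mu> by (auto simp: inv_word_image_iff[OF assms] lecture_hall_def)
    qed
  qed
  then show ?thesis by (rule bij_betw_same_card)
qed

section \<open>The lecture hall count\<close>

lemma tri_Suc: "tri (Suc q) = tri q + (q + 2)"
  by (simp add: tri_def numeral_2_eq_2)

lemma tri_0: "tri 0 = 1"
  by (simp add: tri_def numeral_2_eq_2)

text \<open>The ratio of consecutive triangular numbers; it converts a factor \<open>q + 3\<close>
  back to \<open>q + 1\<close> in the odd case.\<close>

lemma tri_mult: "tri (Suc q) * (q + 1) = tri q * (q + 3)"
proof -
  have "2 * tri q = (q + 2) * (q + 1)" for q
    by (induction q) (simp_all add: tri_0 tri_Suc algebra_simps)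
  from this[of q] this[of "Suc q"] have "2 * (tri (Suc q) * (q + 1)) = 2 * (tri q * (q + 3))"
    by (simp add: algebra_simps)
  then show ?thesis by simp
qed

lemma lh_count_0: "lh_count s m 0 = 1"
  by (induction m) auto

lemma lh_count_Suc_Suc:
  "lh_count s (Suc m) (Suc N) = lh_count s (Suc m) N + lh_count s m (Suc N * s m div s (Suc m))"
  by simp

text \<open>For fixed \<open>a\<close>, the two steps of \<open>N\<close> to remainders
  \<open>2 * a + 1\<close> and \<open>2 * a + 2\<close> add the same even count
  \<open>?F q a\<close>, so its multiplier runs through \<open>q + 1\<close>, \<open>q + 2\<close>,
  \<open>q + 3\<close>. By \<open>tri_mult\<close> the last value is the product for
  \<open>Suc a\<close> with multiplier \<open>q + 1\<close>.\<close>

lemma lh_count_odd_step: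
  assumes even: "\<And>q r. r \<le> n \<Longrightarrow> lh_count s_prime (2 * n) (q * n + r) = tri q ^ (n - r) * tri (Suc q) ^ r"
  shows "a \<le> n \<Longrightarrow> lh_count s_prime (2 * n + 1) (q * (2 * n + 1) + 2 * a)
      = tri (Suc q) ^ a * tri q ^ (n - a) * (q + 1)"
    and "a \<le> n \<Longrightarrow> lh_count s_prime (2 * n + 1) (q * (2 * n + 1) + 2 * a + 1)
      = tri (Suc q) ^ a * tri q ^ (n - a) * (q + 2)"
proof -
  let ?G = "lh_count s_prime (2 * n + 1)"
  let ?F = "\<lambda>q a. tri (Suc q) ^ a * tri q ^ (n - a)"
  have idx: "(q * (2 * n + 1) + 2 * a + d) * s_prime (2 * n) div s_prime (Suc (2 * n)) = q * n + a"
    if "a \<le> n" "d = 1 \<or> d = 2 \<and> a < n" for q a d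
  proof -
    have "(q * (2 * n + 1) + 2 * a + d) * s_prime (2 * n) div s_prime (Suc (2 * n))
        = 2 * ((q * (2 * n + 1) + 2 * a + d) * n) div (2 * (2 * n + 1))"
      by (simp add: s_prime_def mult_ac)
    also have "\<dots> = (q * (2 * n + 1) + 2 * a + d) * n div (2 * n + 1)"
      by (rule div_mult_mult1) simp
    also have "\<dots> = q * n + a"
    \<comment> \<open>The remainder of this division is \<open>d * n - a\<close>, which lies between
      0 and \<open>2 * n\<close>.\<close>
    proof (rule div_nat_eqI)
      show "(2 * n + 1) * (q * n + a) \<le> (q * (2 * n + 1) + 2 * a + d) * n"
        using that by (auto simp: algebra_simps)
      show "(q * (2 * n + 1) + 2 * a + d) * n < (2 * n + 1) * Suc (q * n + a)"
        using that by (auto simp: algebra_simps)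
    qed
    finally show ?thesis .
  qed
  have up1: "?G (q * (2 * n + 1) + 2 * a + 1) = ?F q a * (q + 2)"
    if "a \<le> n" "?G (q * (2 * n + 1) + 2 * a) = ?F q a * (q + 1)" for q a
    using that lh_count_Suc_Suc[of s_prime "2 * n" "q * (2 * n + 1) + 2 * a"] idx[of a 1 q] even[of a q]
    by (simp add: algebra_simps del: lh_count.simps)
  have up2: "?G (q * (2 * n + 1) + 2 * Suc a) = ?F q (Suc a) * (q + 1)"
    if "a < n" "?G (q * (2 * n + 1) + 2 * a + 1) = ?F q a * (q + 2)" for q a
  proof -
    have "?G (q * (2 * n + 1) + 2 * Suc a) = ?F q a * (q + 3)"
      using that lh_count_Suc_Suc[of s_prime "2 * n" "q * (2 * n + 1) + 2 * a + 1"] idx[of a 2 q] even[of a q]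
      by (simp add: algebra_simps del: lh_count.simps)
    also have "\<dots> = tri (Suc q) ^ a * tri q ^ (n - Suc a) * (tri q * (q + 3))"
      using that by (simp add: Suc_diff_Suc[symmetric])
    also have "\<dots> = ?F q (Suc a) * (q + 1)"
      by (simp only: tri_mult[symmetric] power_Suc mult_ac)
    finally show ?thesis .
  qed
  have row: "?G (q * (2 * n + 1) + 2 * a) = ?F q a * (q + 1)"
    if "?G (q * (2 * n + 1)) = ?F q 0 * (q + 1)" "a \<le> n" for q a
    using that(2)
  proof (induction a)
    case (Suc a)
    then show ?case using up2[OF _ up1] by (simp del: lh_count.simps)
  qed (use that(1) in \<open>simp del: lh_count.simps\<close>)
  have start: "?G (q * (2 * n + 1)) = ?F q 0 * (q + 1)" for q
  proof (induction q)
    case 0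
    show ?case using lh_count_0[of s_prime "2 * n + 1"] by (simp add: tri_0 del: lh_count.simps)
  next
    case (Suc q)
    \<comment> \<open>One step past \<open>a = n\<close> reaches \<open>Suc q * (2 * n + 1)\<close>,
      the start of the next row.\<close>
    from up1[OF _ row[OF Suc], of n] show ?case by (simp add: algebra_simps del: lh_count.simps)
  qed
  show 1: "?G (q * (2 * n + 1) + 2 * a) = ?F q a * (q + 1)" if "a \<le> n" using row[OF start that] .
  show "?G (q * (2 * n + 1) + 2 * a + 1) = ?F q a * (q + 2)" if "a \<le> n" using up1[OF that 1[OF that]] .
qed

text \<open>Each unit step of \<open>N\<close> adds an odd count with multiplier
  \<open>q + 2\<close>; by \<open>tri_Suc\<close> this turns one factor \<open>tri q\<close> into
  \<open>tri (Suc q)\<close>. After a full row all factors have changed and \<open>q\<close>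
  increases.\<close>

lemma lh_count_even:
  "r \<le> n \<Longrightarrow> lh_count s_prime (2 * n) (q * n + r) = tri q ^ (n - r) * tri (Suc q) ^ r"
proof (induction n arbitrary: q r)
  case (Suc n)
  let ?G = "lh_count s_prime (2 * n + 2)"
  let ?F = "\<lambda>q r. tri q ^ (Suc n - r) * tri (Suc q) ^ r"
  have idx: "(q * Suc n + r + 1) * s_prime (2 * n + 1) div s_prime (Suc (2 * n + 1)) = q * (2 * n + 1) + 2 * r + 1"
    if "r \<le> n" for q r
  proof -
    have "s_prime (2 * n + 1) = 2 * (2 * n + 1)" "s_prime (Suc (2 * n + 1)) = 2 * Suc n"
      by (simp_all add: s_prime_def)
    then have "(q * Suc n + r + 1) * s_prime (2 * n + 1) div s_prime (Suc (2 * n + 1))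
        = 2 * ((q * Suc n + r + 1) * (2 * n + 1)) div (2 * Suc n)"
      by (simp only: mult_ac)
    also have "\<dots> = (q * Suc n + r + 1) * (2 * n + 1) div Suc n"
      by (rule div_mult_mult1) simp
    also have "\<dots> = q * (2 * n + 1) + 2 * r + 1"
      \<comment> \<open>The remainder is \<open>n - r\<close>.\<close>
      by (rule div_nat_eqI) (use that in \<open>auto simp: algebra_simps\<close>)
    finally show ?thesis .
  qed
  have up: "?G (q * Suc n + Suc r) = ?F q (Suc r)" if "r \<le> n" "?G (q * Suc n + r) = ?F q r" for q r
  proof -
    have "?G (q * Suc n + Suc r) = ?F q r + tri (Suc q) ^ r * tri q ^ (n - r) * (q + 2)"
      using that lh_count_Suc_Suc[of s_prime "2 * n + 1" "q * Suc n + r"] idx[of r q]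
        lh_count_odd_step(2)[OF Suc.IH, of r q]
      by (simp del: lh_count.simps)
    also have "\<dots> = tri q ^ (n - r) * tri (Suc q) ^ r * (tri q + (q + 2))"
      using that by (simp add: Suc_diff_le algebra_simps)
    also have "\<dots> = ?F q (Suc r)"
      unfolding tri_Suc[symmetric] by simp
    finally show ?thesis .
  qed
  have row: "?G (q * Suc n + r) = ?F q r" if "?G (q * Suc n) = ?F q 0" "r \<le> Suc n" for q r
    using that(2) by (induction r) (use that(1) up in auto)
  have start: "?G (q * Suc n) = ?F q 0" for q
  proof (induction q)
    case 0
    show ?case using lh_count_0[of s_prime "2 * n + 2"] by (simp add: tri_0 del: lh_count.simps)
  next
    case (Suc q)
    from row[OF Suc, of "Suc n"] show ?case by (simp add: algebra_simps del: lh_count.simps)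
  qed
  show ?case using row[OF start Suc.prems, of q] by simp
qed simp

lemma s_prime_pos: "i > 0 \<Longrightarrow> s_prime i > 0"
  by (simp add: s_prime_def)

text \<open>The bound \<open>t\<close> means \<open>N = t * s_prime m\<close>, which is
  \<open>2 * t\<close> full rows with remainder 0 for either parity of \<open>m\<close>.\<close>

lemma card_lecture_hall_s_prime:
  "card (lecture_hall s_prime (2 * n) (of_nat t)) = tri (2 * t) ^ n"
  "card (lecture_hall s_prime (2 * n + 1) (of_nat t)) = tri (2 * t) ^ n * (2 * t + 1)"
proof -
  have lh: "card (lecture_hall s_prime m (of_nat t)) = lh_count s_prime m (t * s_prime m)" if "m > 0" for m
    using card_lecture_hall[of s_prime m "t * s_prime m"] s_prime_pos that by simp
  show "card (lecture_hall s_prime (2 * n) (of_nat t)) = tri (2 * t) ^ n"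
  \<comment> \<open>As \<open>s_prime 0\<close> is 0, the bound \<open>t\<close> cannot be written
    over this denominator when \<open>n = 0\<close>.\<close>
  proof (cases "n = 0")
    case True
    have "lecture_hall s_prime 0 (of_nat t) = {[]}" by (auto simp: lecture_hall_def)
    with True show ?thesis by simp
  next
    case False
    then show ?thesis using lh_count_even[of 0 n "2 * t"] by (simp add: lh s_prime_def mult_ac)
  qed
  show "card (lecture_hall s_prime (2 * n + 1) (of_nat t)) = tri (2 * t) ^ n * (2 * t + 1)"
    using lh_count_odd_step(1)[where n = n and a = 0 and q = "2 * t", OF lh_count_even] lh[of "2 * n + 1"]
    by (simp add: s_prime_def mult_ac del: lh_count.simps)
qed

section \<open>Comparing the two families\<close>

lemma des_B_asc_distribution_eqI:
  assumes "size M = m"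
    and "\<And>t. card (msets_over (letters t) (\<lambda>p. \<bar>snd p\<bar>) M) = card (lecture_hall s_prime m (of_nat t))"
  shows "(\<Sum>\<sigma>\<in>signed_perms M. monom (1::int) (des_B \<sigma>)) = (\<Sum>e\<in>I_prime m. monom (1::int) (asc s_prime e))"
proof -
  have "(\<Sum>\<tau>\<in>signed_perms M. monom (1::int) (desc (0 # \<tau>)))
      = (\<Sum>\<tau>\<in>inv_word s_prime ` inv_seqs s_prime m. monom 1 (desc (0 # \<tau>)))"
  proof (rule desc_distribution_eqI[where m = m])
    show "length \<tau> = m" if "\<tau> \<in> signed_perms M" for \<tau>
      using that assms(1) by (auto simp: signed_perms_def dest: arg_cong[of _ _ size])
    show "length \<tau> = m" if "\<tau> \<in> inv_word s_prime ` inv_seqs s_prime m" for \<tau>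
      using that by (auto simp: inv_word_def inv_seqs_def)
    show "card {w \<in> chains (0, 0) t. map snd w \<in> signed_perms M}
        = card {w \<in> chains (0, 0) t. map snd w \<in> inv_word s_prime ` inv_seqs s_prime m}" for t
      using assms(2)[of t] by (simp add: card_chains_signed_perms card_chains_inv_word s_prime_pos letters_def)
  qed (simp_all add: finite_signed_perms finite_inv_seqs)
  also have "\<dots> = (\<Sum>e\<in>I_prime m. monom 1 (asc s_prime e))"
    by (subst sum.reindex) (simp_all add: inj_on_inv_word s_prime_pos desc_inv_word I_prime_def)
  finally show ?thesis by (simp add: sum_des_B)
qed

theorem theorem3p2:
  fixes n :: nat
  assumes "n \<ge> 1"
  shows "(\<Sum>\<sigma>\<in>P_perms n. monom (1::int) (des_B \<sigma>)) = (\<Sum>e\<in>I_prime (2 * n). monom (1::int) (asc s_prime e)) \<and>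
         (\<Sum>\<sigma>\<in>U_perms n. monom (1::int) (des_B \<sigma>)) = (\<Sum>e\<in>I_prime (2 * n - 1). monom (1::int) (asc s_prime e))"
proof
  have size: "size (\<Sum>k\<in>{1..n}. replicate_mset 2 (int k)) = 2 * n" for n
    by (simp add: size_multiset_sum)
  show "(\<Sum>\<sigma>\<in>P_perms n. monom (1::int) (des_B \<sigma>)) = (\<Sum>e\<in>I_prime (2 * n). monom (1::int) (asc s_prime e))"
    unfolding P_perms_def
    by (rule des_B_asc_distribution_eqI) (simp_all only: size card_msets_over_P card_lecture_hall_s_prime)
  \<comment> \<open>With \<open>n = Suc k\<close> the truncated differences become \<open>k\<close>
    and \<open>2 * k + 1\<close>, the shapes in the odd count.\<close>
  obtain k where n: "n = Suc k" using assms by (cases n) auto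
  then have m: "2 * n - 1 = 2 * k + 1" and k: "n - 1 = k" by simp_all
  show "(\<Sum>\<sigma>\<in>U_perms n. monom (1::int) (des_B \<sigma>)) = (\<Sum>e\<in>I_prime (2 * n - 1). monom (1::int) (asc s_prime e))"
    unfolding U_perms_def m k
  proof (rule des_B_asc_distribution_eqI)
    show "size ((\<Sum>k\<in>{1..k}. replicate_mset 2 (int k)) + {#int n#}) = 2 * k + 1"
      by (simp only: size size_union size_single)
  qed (simp only: n card_msets_over_U card_lecture_hall_s_prime)
qed

end
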